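(* Let $\kappa>0$ be a real number, let $\Phi$ be the standard normal distribution function, and define $$g_\kappa(\sigma):=\Phi\left(\frac{\ln\kappa}{\sigma}+\frac{\sigma}{2}\right),\quad \sigma\in(0,\infty).$$ (i) If $\kappa\leq 1$, then $$\inf_{\sigma\in(0,\infty)}g_{\kappa}(\sigma)=\lim_{\sigma\to 0+}g_{\kappa}(\sigma)=\begin{cases}0,&\text{if }\kappa<1,\\ \frac12,&\text{if }\kappa=1.\end{cases}$$ (ii) If $\kappa>1$, then $g_\kappa$ attains its minimum over $(0,\infty)$ at $\sigma=\sqrt{2\ln\kappa}$, and $$\min_{\sigma\in(0,\infty)}g_{\kappa}(\sigma)=g_{\kappa}\left(\sqrt{2\ln\kappa}\right)=\Phi\left(\sqrt{2\ln\kappa}\right)>\frac12.$$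
   Context: $\Phi(z)=\frac{1}{\sqrt{2\pi}}\int_{-\infty}^{z}e^{-t^2/2}\,dt$ is the distribution function of the standard normal distribution. Origin of $g_\kappa$: if $X_{\mu,\sigma}$ is a log-normal random variable with parameters $\mu\in\mathbb{R},\sigma>0$, i.e. with density $\frac{1}{\sqrt{2\pi}\sigma x}\exp\left(-\frac{(\ln x-\mu)^2}{2\sigma^2}\right)$ for $x>0$, whose expectation is $\exp(\mu+\sigma^2/2)$, then $P(X_{\mu,\sigma}\leq\kappa E[X_{\mu,\sigma}])=g_\kappa(\sigma)$. *)

theory Defs
  imports "HOL-Probability.Probability"
begin

definition Phi :: "real \<Rightarrow> real" where
  "Phi = cdf std_normal_distribution"

definition g :: "real \<Rightarrow> real \<Rightarrow> real" where
  "g \<kappa> \<sigma> = Phi (ln \<kappa> / \<sigma> + \<sigma> / 2)"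

lemma Phi_eq_integral:
  "Phi z = 1 / sqrt (2 * pi) * (LBINT t:{..z}. exp (- t\<^sup>2 / 2))"
proof -
  have "Phi z = (LINT t|std_normal_distribution. indicator {..z} t)"
    by (simp add: Phi_def cdf_def)
  also have "\<dots> = (LINT t|lborel. indicator {..z} t * std_normal_density t)"
    by (subst integral_density) (simp_all add: mult.commute)
  also have "\<dots> = 1 / sqrt (2 * pi) * (LBINT t:{..z}. exp (- t\<^sup>2 / 2))"
    unfolding set_lebesgue_integral_def std_normal_density_def
    by (subst integral_mult_right_zero[symmetric]) (simp add: mult_ac)
  finally show ?thesis .
qed

text \<open>The infimum of \<open>g \<kappa>\<close> over a nonempty set is thus a genuine one.\<close>

lemma bdd_below_g: "bdd_below (g \<kappa> ` S)"
  by (rule bdd_belowI[of _ 0]) (auto simp: g_def Phi_def cdf_def)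

end

theory Submission
  imports Defs "HOL-Real_Asymp.Real_Asymp"
begin

text \<open>
  Since \<open>Phi\<close> is increasing, everything is decided by the argument \<open>ln \<kappa> / \<sigma> + \<sigma> / 2\<close>. As \<open>\<sigma>\<close>
  decreases to \<open>0\<close> it tends to minus infinity if \<open>\<kappa> < 1\<close>, and it stays positive and tends to \<open>0\<close>
  if \<open>\<kappa> = 1\<close>. If \<open>\<kappa> > 1\<close>, AM-GM bounds it below by \<open>sqrt (2 * ln \<kappa>)\<close>, with equality at
  \<open>\<sigma> = sqrt (2 * ln \<kappa>)\<close>.
\<close>

interpretation std_normal: real_distribution std_normal_distribution
  by (rule real_dist_normal_dist)

lemma Phi_mono: "x \<le> y \<Longrightarrow> Phi x \<le> Phi y"
  unfolding Phi_def by (rule std_normal.cdf_nondecreasing)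

text \<open>Absence of atoms gives continuity of \<open>Phi\<close> and lets rays be opened or
  closed freely in the reflection argument.\<close>

lemma measure_std_normal_singleton: "measure std_normal_distribution {x} = 0"
proof -
  have "emeasure std_normal_distribution {x} = 0"
    by (simp add: emeasure_density nn_integral_indicator_singleton')
  then show ?thesis
    by (simp add: measure_def)
qed

lemma isCont_Phi: "isCont Phi x"
  unfolding Phi_def using std_normal.isCont_cdf measure_std_normal_singleton by simp

text \<open>The density vanishes nowhere, so an interval of positive length carries positive mass.
  The final strict bound \<open>1 / 2\<close> rests on this.\<close>

lemma Phi_strict_mono:
  assumes "x < y"
  shows "Phi x < Phi y"
proof -
  have "emeasure std_normal_distribution {x<..y} \<noteq> 0"
  proof
    assume "emeasure std_normal_distribution {x<..y} = 0"
    \<comment> \<open>The integral of the density over the interval is zero; positivity of the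
      density turns this into a Lebesgue null set.\<close>
    then have "AE t in lborel. t \<notin> {x<..y}"
      by (subst (asm) emeasure_density)
        (auto simp: nn_integral_0_iff_AE std_normal_density_def indicator_def not_le[symmetric] split: if_splits)
    then have "emeasure lborel {x<..y} = 0"
      by (subst (asm) AE_iff_measurable[OF _ refl]) (auto simp: greaterThanAtMost_def greaterThan_def atMost_def Int_def)
    with assms show False
      by simp
  qed
  then have "0 < measure std_normal_distribution {x<..y}"
    by (simp add: std_normal.emeasure_eq_measure zero_less_measure_iff)
  then show ?thesis
    using std_normal.cdf_diff_eq[OF assms] by (simp add: Phi_def)
qed

text \<open>The density is even, so the reflection of \<open>t\<close> to \<open>- t\<close>
  preserves the measure. At \<open>0\<close> this yields the value of \<open>Phi\<close>
  there.\<close>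

lemma Phi_minus: "Phi (- x) = 1 - Phi x"
proof -
  have "emeasure std_normal_distribution {..- x} = emeasure std_normal_distribution {x..}"
    using nn_integral_real_affine[of "\<lambda>t. ennreal (std_normal_density t) * indicator {..- x} t" "-1" 0]
    by (auto simp: emeasure_density std_normal_density_def indicator_def intro!: nn_integral_cong)
  then have "Phi (- x) = measure std_normal_distribution {x..}"
    by (simp add: Phi_def cdf_def measure_def)
  \<comment> \<open>The closed ray exceeds the complement of \<open>{..x}\<close> by the point
    \<open>x\<close> alone, which has mass zero.\<close>
  also have "{x..} = {x} \<union> (space std_normal_distribution - {..x})"
    by auto
  also have "measure std_normal_distribution \<dots> = measure std_normal_distribution (space std_normal_distribution - {..x})"
    by (subst std_normal.finite_measure_Union) (auto simp: measure_std_normal_singleton)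
  also have "\<dots> = 1 - Phi x"
    by (subst std_normal.prob_compl) (auto simp: Phi_def cdf_def)
  finally show ?thesis .
qed

lemma Phi_0: "Phi 0 = 1 / 2"
  using Phi_minus[of 0] by simp

text \<open>A lower bound that is also a one-sided limit is the infimum: the infimum lies below
  every value, hence below the limit.\<close>

lemma INF_greaterThan_eq_limit_at_right:
  fixes f :: "real \<Rightarrow> real"
  assumes lim: "(f \<longlongrightarrow> l) (at_right a)" and ge: "\<And>x. a < x \<Longrightarrow> l \<le> f x"
  shows "(INF x\<in>{a<..}. f x) = l"
proof (rule antisym)
  show "l \<le> (INF x\<in>{a<..}. f x)"
    using ge by (intro cINF_greatest) auto
  have "bdd_below (f ` {a<..})"
    using ge by (intro bdd_belowI2[of _ l]) auto
  then have "\<forall>\<^sub>F x in at_right a. (INF x\<in>{a<..}. f x) \<le> f x"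
    by (auto simp: eventually_at_filter intro!: always_eventually cINF_lower)
  with lim show "(INF x\<in>{a<..}. f x) \<le> l"
    by (rule tendsto_lowerbound) simp
qed

lemma g_tendsto_at_right_0:
  assumes "0 < \<kappa>" "\<kappa> \<le> 1"
  shows "(g \<kappa> \<longlongrightarrow> (if \<kappa> < 1 then 0 else 1 / 2)) (at_right 0)"
proof (cases "\<kappa> < 1")
  case True
  define c where "c = ln \<kappa>"
  have "c < 0"
    using True assms by (simp add: c_def)
  then have "filterlim (\<lambda>\<sigma>. c / \<sigma> + \<sigma> / 2) at_bot (at_right 0)"
    by real_asymp
  with std_normal.cdf_lim_at_bot have "((\<lambda>\<sigma>. Phi (c / \<sigma> + \<sigma> / 2)) \<longlongrightarrow> 0) (at_right 0)"
    unfolding Phi_def by (rule filterlim_compose)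
  with True show ?thesis
    by (simp add: g_def[abs_def] c_def)
next
  case False
  \<comment> \<open>Here \<open>\<kappa> = 1\<close>, so \<open>ln \<kappa>\<close> vanishes and
    only \<open>\<sigma> / 2\<close> remains inside \<open>Phi\<close>.\<close>
  have "((\<lambda>\<sigma>::real. \<sigma> / 2) \<longlongrightarrow> 0) (at_right 0)"
    by real_asymp
  then have "((\<lambda>\<sigma>. Phi (\<sigma> / 2)) \<longlongrightarrow> Phi 0) (at_right 0)"
    by (rule isCont_tendsto_compose[OF isCont_Phi])
  with False assms show ?thesis
    by (simp add: g_def[abs_def] Phi_0)
qed

lemma g_lower_bound:
  assumes "0 < \<kappa>" "\<kappa> \<le> 1" "0 < \<sigma>"
  shows "(if \<kappa> < 1 then 0 else 1 / 2) \<le> g \<kappa> \<sigma>"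
proof (cases "\<kappa> < 1")
  case True
  then show ?thesis
    by (simp add: g_def Phi_def std_normal.cdf_nonneg)
next
  case False
  then show ?thesis
    using assms Phi_mono[of 0 "\<sigma> / 2"] by (simp add: g_def Phi_0)
qed

text \<open>AM-GM as a completed square: the right side minus the left is
  \<open>(sqrt (2 * c) - \<sigma>)\<^sup>2 / (2 * \<sigma>)\<close>.\<close>

lemma sqrt_le_div_add_half:
  fixes c \<sigma> :: real
  assumes "0 \<le> c" "0 < \<sigma>"
  shows "sqrt (2 * c) \<le> c / \<sigma> + \<sigma> / 2"
proof -
  have "0 \<le> (sqrt (2 * c) - \<sigma>)\<^sup>2 / (2 * \<sigma>)"
    using assms by simp
  also have "\<dots> = c / \<sigma> + \<sigma> / 2 - sqrt (2 * c)"
    using assms by (simp add: power2_diff field_simps) (simp add: power2_eq_square)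
  finally show ?thesis
    by simp
qed

text \<open>The equality case of AM-GM: at this point both summands inside \<open>Phi\<close> equal
  half the square root.\<close>

lemma g_at_sqrt:
  assumes "1 < \<kappa>"
  shows "g \<kappa> (sqrt (2 * ln \<kappa>)) = Phi (sqrt (2 * ln \<kappa>))"
proof -
  define s where "s = sqrt (2 * ln \<kappa>)"
  have "0 < s" "s\<^sup>2 = 2 * ln \<kappa>"
    using assms by (simp_all add: s_def)
  then have "ln \<kappa> / s + s / 2 = s"
    by (simp add: field_simps power2_eq_square)
  then show ?thesis
    by (simp add: g_def s_def)
qed

theorem proposition3p1:
  fixes \<kappa> :: real
  assumes "\<kappa> > 0"
  shows "(\<kappa> \<le> 1 \<longrightarrow>
            (g \<kappa> \<longlongrightarrow> (INF \<sigma>\<in>{0<..}. g \<kappa> \<sigma>)) (at_right 0) \<and>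
            (INF \<sigma>\<in>{0<..}. g \<kappa> \<sigma>) = (if \<kappa> < 1 then 0 else 1 / 2)) \<and>
         (\<kappa> > 1 \<longrightarrow>
            is_arg_min (g \<kappa>) (\<lambda>\<sigma>. \<sigma> \<in> {0<..}) (sqrt (2 * ln \<kappa>)) \<and>
            (LEAST m. m \<in> g \<kappa> ` {0<..}) = g \<kappa> (sqrt (2 * ln \<kappa>)) \<and>
            g \<kappa> (sqrt (2 * ln \<kappa>)) = Phi (sqrt (2 * ln \<kappa>)) \<and>
            Phi (sqrt (2 * ln \<kappa>)) > 1 / 2)"
proof (rule conjI; rule impI)
  assume le: "\<kappa> \<le> 1"
  have "(INF \<sigma>\<in>{0<..}. g \<kappa> \<sigma>) = (if \<kappa> < 1 then 0 else 1 / 2)"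
    by (rule INF_greaterThan_eq_limit_at_right[OF g_tendsto_at_right_0[OF assms le]
          g_lower_bound[OF assms le]])
  with g_tendsto_at_right_0[OF assms le]
  show "(g \<kappa> \<longlongrightarrow> (INF \<sigma>\<in>{0<..}. g \<kappa> \<sigma>)) (at_right 0) \<and>
        (INF \<sigma>\<in>{0<..}. g \<kappa> \<sigma>) = (if \<kappa> < 1 then 0 else 1 / 2)"
    by simp
next
  assume gt: "1 < \<kappa>"
  let ?s = "sqrt (2 * ln \<kappa>)"
  have pos: "0 < ?s"
    using gt by simp
  have min: "g \<kappa> ?s \<le> g \<kappa> \<sigma>" if "0 < \<sigma>" for \<sigma>
    \<comment> \<open>Rewriting the value at \<open>?s\<close> first leaves a comparison of two
      values of \<open>Phi\<close>, whose arguments are ordered by AM-GM.\<close>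
    unfolding g_at_sqrt[OF gt] unfolding g_def
    using gt that by (intro Phi_mono sqrt_le_div_add_half) auto
  have "is_arg_min (g \<kappa>) (\<lambda>\<sigma>. \<sigma> \<in> {0<..}) ?s"
    using pos min by (auto simp: is_arg_min_linorder)
  moreover have "(LEAST m. m \<in> g \<kappa> ` {0<..}) = g \<kappa> ?s"
    using pos min by (intro Least_equality) auto
  moreover have "Phi ?s > 1 / 2"
    using Phi_strict_mono[OF pos] by (simp add: Phi_0)
  ultimately show "is_arg_min (g \<kappa>) (\<lambda>\<sigma>. \<sigma> \<in> {0<..}) ?s \<and>
      (LEAST m. m \<in> g \<kappa> ` {0<..}) = g \<kappa> ?s \<and> g \<kappa> ?s = Phi ?s \<and> Phi ?s > 1 / 2"
    using g_at_sqrt[OF gt] by blast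
qed

end
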